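(* Let $n\ge4$, $1\le m\le\lfloor n/2\rfloor$, let $W$ be the Coxeter group of type $D_n$, and let $w=(m,m-1,\dots,2,\overline1)(n,n-1,\dots,m+2,\overline{m+1})\in W$. Let $w_0$ be a divisor of $w$ of type I, i.e. $w_0=w(i,j)$ or $w_0=w(\overline i,\overline j)$ with $1\le i\le m$ and $m+1\le j\le n$; as a marked permutation $w_0$ is a single cycle $(x_1,x_2,\dots,x_n)$ with an even number of overlined entries. Let $r_1,r_2,\dots,r_{n-1}$ be the reflections applied, in this order, in the type I procedure for $(x_1,\dots,x_n)$. Then $$w_0=r_{n-1}r_{n-2}\cdots r_2r_1$$ is a reduced decomposition of $w_0$ over the set $T$ of reflections of $W$.
   Context: $W$ is the group of $n\times n$ monomial matrices whose nonzero entries are $\pm1$ with product $1$. A marked cycle $(x_1,\dots,x_k)$, each $x_a$ being $p_a$ or $\overline{p_a}$ with $p_1,\dots,p_k\in\{1,\dots,n\}$ distinct, means that row $p_a$ has its nonzero entry in column $p_{a+1}$ (indices mod $k$), equal to $-1$ if $x_a$ is overlined and to $1$ otherwise; elements are written as products of disjoint marked cycles, unmarked $1$-cycles being omitted. By convention $\overline{\overline p}=p$, and a cycle of length $\ge3$ containing $n$ (or $\overline n$) is written starting with that entry. The set of reflections is $T=\{(i,j),(\overline i,\overline j):1\le i\neq j\le n\}$. $\ell_T(v)$ is the least number of elements of $T$ whose product is $v$; a decomposition of $v$ as a product of $\ell_T(v)$ elements of $T$ is called reduced. Type I procedure for a marked cycle $(x_1,\dots,x_r)$: for $k=1,\dots,r-1$,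 if $x_k=p$ and $x_{k+1}\in\{q,\overline q\}$, multiply $(x_k,x_{k+1},\dots,x_r)$ on the right by the reflection $(p,q)$, obtaining $(p)(x_{k+1},\dots,x_r)$; if $x_k=\overline p$ and $x_{k+1}\in\{q,\overline q\}$, multiply $(x_k,x_{k+1},\dots,x_r)$ on the right by $(\overline p,\overline q)$, obtaining $(p)(x_{k+1},\dots,\overline{x_r})$. The reflection applied at step $k$ is $r_k$; thus, with $p_k$ the underlying number of $x_k$, $r_k=(p_k,p_{k+1})$ if $x_k$ is not overlined and $r_k=(\overline{p_k},\overline{p_{k+1}})$ if $x_k$ is overlined. *)

theory Defs
  imports "Jordan_Normal_Form.Matrix" "HOL-Algebra.Group"
begin

text \<open>Marked entries are nonzero integers: the overlined number \<open>p\<close> is the integer \<open>- p\<close>, so that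
  overlining is negation and the underlying number is the absolute value.  Matrices are indexed
  from \<open>0\<close>, whereas rows and columns are numbered \<open>1, \<dots>, n\<close>; hence the shifts by one below.\<close>

definition type_D :: "nat \<Rightarrow> int mat monoid" where
  "type_D n = \<lparr>carrier = {A \<in> carrier_mat n n.
       (\<forall>i<n. \<exists>!j. j < n \<and> A $$ (i, j) \<noteq> 0) \<and>
       (\<forall>j<n. \<exists>!i. i < n \<and> A $$ (i, j) \<noteq> 0) \<and>
       (\<forall>i<n. \<forall>j<n. A $$ (i, j) \<noteq> 0 \<longrightarrow> A $$ (i, j) = 1 \<or> A $$ (i, j) = - 1) \<and>
       (\<Prod>(i, j) \<in> {(i, j). i < n \<and> j < n \<and> A $$ (i, j) \<noteq> 0}. A $$ (i, j)) = 1},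
     mult = (*), one = 1\<^sub>m n\<rparr>"

definition is_marked_cycle :: "nat \<Rightarrow> int list \<Rightarrow> bool" where
  "is_marked_cycle n xs \<longleftrightarrow>
     xs \<noteq> [] \<and> distinct (map abs xs) \<and> abs ` set xs \<subseteq> {1..int n}"

definition marked_cycle :: "nat \<Rightarrow> int list \<Rightarrow> int mat" where
  "marked_cycle n xs = mat n n (\<lambda>(i, j). let p = int (Suc i); q = int (Suc j) in
     if \<exists>a<length xs. xs ! a = p \<and> \<bar>xs ! (Suc a mod length xs)\<bar> = q then 1
     else if \<exists>a<length xs. xs ! a = - p \<and> \<bar>xs ! (Suc a mod length xs)\<bar> = q then - 1
     else if p = q \<and> p \<notin> abs ` set xs then 1
     else 0)"

text \<open>The last conjunct is the normalisation that a cycle of length at least \<open>3\<close> containing \<open>n\<close>,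
  overlined or not, is written starting with that entry.\<close>

definition is_cycle_notation :: "nat \<Rightarrow> int mat \<Rightarrow> int list \<Rightarrow> bool" where
  "is_cycle_notation n v xs \<longleftrightarrow> is_marked_cycle n xs \<and> v = marked_cycle n xs \<and>
     (length xs \<ge> 3 \<and> int n \<in> abs ` set xs \<longrightarrow> \<bar>hd xs\<bar> = int n)"

definition reflections :: "nat \<Rightarrow> int mat set" where
  "reflections n = {t. \<exists>i\<in>{1..int n}. \<exists>j\<in>{1..int n}. i \<noteq> j \<and>
     (t = marked_cycle n [i, j] \<or> t = marked_cycle n [- i, - j])}"

definition list_product :: "('a, 'b) monoid_scheme \<Rightarrow> 'a list \<Rightarrow> 'a" where
  "list_product G ts = foldr (mult G) ts (one G)"

definition word_length :: "('a, 'b) monoid_scheme \<Rightarrow> 'a set \<Rightarrow> 'a \<Rightarrow> nat" where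
  "word_length G T v = (LEAST k. \<exists>ts. set ts \<subseteq> T \<and> length ts = k \<and> list_product G ts = v)"

definition reduced_decomposition ::
    "('a, 'b) monoid_scheme \<Rightarrow> 'a set \<Rightarrow> 'a \<Rightarrow> 'a list \<Rightarrow> bool" where
  "reduced_decomposition G T v ts \<longleftrightarrow>
     set ts \<subseteq> T \<and> length ts = word_length G T v \<and> list_product G ts = v"

text \<open>\<open>type_I_reflections n [x\<^sub>1, \<dots>, x\<^sub>r]\<close> is the list of the reflections applied in the type I
  procedure, in order of application; the argument of the recursive call is the marked cycle
  remaining after the current step, whose last entry has changed its mark if \<open>x\<close> is overlined.\<close>

fun type_I_reflections :: "nat \<Rightarrow> int list \<Rightarrow> int mat list" where
  "type_I_reflections n (x # y # zs) =
     (if x > 0 then marked_cycle n [\<bar>x\<bar>, \<bar>y\<bar>] # type_I_reflections n (y # zs)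
      else marked_cycle n [- \<bar>x\<bar>, - \<bar>y\<bar>] #
        type_I_reflections n (butlast (y # zs) @ [- last (y # zs)]))"
| "type_I_reflections n xs = []"

lemma length_type_I_reflections: "length (type_I_reflections n xs) = length xs - 1"
  by (induction n xs rule: type_I_reflections.induct) auto

lemma nth_type_I_reflections:
  assumes "Suc k < length xs"
  shows "type_I_reflections n xs ! k =
    (if xs ! k > 0 then marked_cycle n [\<bar>xs ! k\<bar>, \<bar>xs ! Suc k\<bar>]
     else marked_cycle n [- \<bar>xs ! k\<bar>, - \<bar>xs ! Suc k\<bar>])"
  using assms
proof (induction n xs arbitrary: k rule: type_I_reflections.induct)
  case (1 n x y zs)
  define us where "us = butlast (y # zs) @ [- last (y # zs)]"
  have len: "length us = length (y # zs)"
    by (simp add: us_def)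
  have abs_nth: "\<bar>us ! l\<bar> = \<bar>(y # zs) ! l\<bar>" if "l < length (y # zs)" for l
    using that unfolding us_def
    by (cases "l = length zs") (auto simp: nth_append nth_butlast last_conv_nth simp del: butlast.simps)
  have eq_nth: "us ! l = (y # zs) ! l" if "Suc l < length (y # zs)" for l
    using that unfolding us_def by (auto simp: nth_append nth_butlast simp del: butlast.simps)
  show ?case
  proof (cases k)
    case 0
    then show ?thesis by simp
  next
    case (Suc l)
    then have l: "Suc l < length (y # zs)" using "1.prems" by simp
    show ?thesis
    proof (cases "x > 0")
      case True
      then show ?thesis using "1.IH"(1)[OF True l] Suc by simp
    next
      case False
      have "type_I_reflections n (x # y # zs) ! k = type_I_reflections n us ! l"
        using False Suc by (simp add: us_def)
      also have "\<dots> = (if us ! l > 0 then marked_cycle n [\<bar>us ! l\<bar>, \<bar>us ! Suc l\<bar>]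
          else marked_cycle n [- \<bar>us ! l\<bar>, - \<bar>us ! Suc l\<bar>])"
        using "1.IH"(2)[OF False] l len unfolding us_def by metis
      finally show ?thesis using eq_nth[OF l] abs_nth[OF l] Suc by simp
    qed
  qed
qed auto

end

theory Submission
  imports Defs
begin

text \<open>
  Multiplying two disjoint marked cycles on the right by a reflection that exchanges their first
  entries concatenates them, the last entry of each changing its mark if the reflection is
  overlined.  After rotating the two cycles of \<open>w\<close> this shows that \<open>w\<^sub>0\<close> is an \<open>n\<close>-cycle; applied
  with the trivial cycle \<open>(p)\<close> as first factor it is the inverse of a type I step.  Since the
  nonzero entries of \<open>w\<^sub>0\<close> have product \<open>1\<close>, the number of overlined entries is even; a type I step keeps
  its parity, so the procedure ends at an unmarked \<open>1\<close>-cycle, i.e. the identity.  Conversely, \<open>k\<close>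
  reflections connect the \<open>n\<close> rows into at least \<open>n - k\<close> classes that their product preserves,
  while an \<open>n\<close>-cycle acts transitively, so \<open>k \<ge> n - 1\<close>.
\<close>

subsection \<open>Signed permutations\<close>

text \<open>Signed permutations are kept as functions on the integers, with overlining as negation,
  so that matrix products become compositions. Only the values at \<open>1, ..., n\<close> enter the
  matrix.\<close>

definition signed_mat :: "nat \<Rightarrow> (int \<Rightarrow> int) \<Rightarrow> int mat" where
  "signed_mat n g = mat n n (\<lambda>(i, j). let p = int (Suc i) in
     if \<bar>g p\<bar> = int (Suc j) then sgn (g p) else 0)"

text \<open>Oddness is required because in a composition the outer function is evaluated at possibly
  negative values; it reduces these to the values at positive integers.\<close>

definition signed_perm :: "nat \<Rightarrow> (int \<Rightarrow> int) \<Rightarrow> bool" where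
  "signed_perm n g \<longleftrightarrow> (\<forall>p. g (- p) = - g p) \<and> bij_betw (\<lambda>p. \<bar>g p\<bar>) {1..int n} {1..int n}"

lemma signed_mat_carrier [simp]: "signed_mat n g \<in> carrier_mat n n"
  by (simp add: signed_mat_def)

lemma signed_mat_cong:
  assumes "\<And>p. p \<in> {1..int n} \<Longrightarrow> g p = h p"
  shows "signed_mat n g = signed_mat n h"
  by (rule eq_matI) (auto simp: signed_mat_def Let_def assms)

lemma odd_function_sgn:
  fixes h :: "int \<Rightarrow> int"
  assumes "\<And>p. h (- p) = - h p"
  shows "h p = sgn p * h \<bar>p\<bar>"
  using assms[of p] assms[of 0] by (cases p "0 :: int" rule: linorder_cases) auto

lemma signed_perm_abs_mem:
  assumes "signed_perm n g" "p \<in> {1..int n}"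
  shows "\<bar>g p\<bar> \<in> {1..int n}"
  using assms unfolding signed_perm_def bij_betw_def by auto

lemma sgn_comp_odd:
  fixes g h :: "int \<Rightarrow> int"
  assumes "\<And>p. h (- p) = - h p"
  shows "sgn (h (g p)) = sgn (g p) * sgn (h \<bar>g p\<bar>)"
  by (metis assms odd_function_sgn sgn_mult sgn_sgn)

text \<open>Row \<open>p\<close> of the left factor has its only nonzero entry in column
  \<open>\<bar>g p\<bar>\<close>, so a single term of each scalar product survives, and oddness of
  \<open>h\<close> absorbs the sign of \<open>g p\<close>. Arguments index rows, hence the left
  factor acts first.\<close>

lemma signed_mat_mult:
  assumes "signed_perm n g" "signed_perm n h"
  shows "signed_mat n g * signed_mat n h = signed_mat n (h \<circ> g)"
proof (rule eq_matI)
  fix i k assume "i < dim_row (signed_mat n (h \<circ> g))" "k < dim_col (signed_mat n (h \<circ> g))"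
  then have ik: "i < n" "k < n" by (simp_all add: signed_mat_def)
  define p where "p = int (Suc i)"
  have odd: "h (- p) = - h p" for p using assms(2) by (auto simp: signed_perm_def)
  have gp: "\<bar>g p\<bar> \<in> {1..int n}"
    using ik by (intro signed_perm_abs_mem[OF assms(1)]) (auto simp: p_def)
  define j where "j = nat (\<bar>g p\<bar> - 1)"
  have j: "j < n" "\<bar>g p\<bar> = int (Suc j)" using gp by (auto simp: j_def)
  have "(signed_mat n g * signed_mat n h) $$ (i, k)
      = (\<Sum>l\<in>{0..<n}. signed_mat n g $$ (i, l) * signed_mat n h $$ (l, k))"
    using ik by (simp add: signed_mat_def scalar_prod_def)
  also have "\<dots> = (\<Sum>l\<in>{0..<n}. if l = j then sgn (g p) * signed_mat n h $$ (j, k) else 0)"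
    using ik j by (intro sum.cong) (auto simp: signed_mat_def Let_def p_def)
  also have "\<dots> = sgn (g p) * signed_mat n h $$ (j, k)"
    using j by simp
  also have "\<dots> = signed_mat n (h \<circ> g) $$ (i, k)"
  proof -
    have "\<bar>h (g p)\<bar> = \<bar>h \<bar>g p\<bar>\<bar>"
      using odd[of "g p"] by (cases "g p \<ge> 0") auto
    moreover have "sgn (h (g p)) = sgn (g p) * sgn (h \<bar>g p\<bar>)"
      by (rule sgn_comp_odd) (rule odd)
    ultimately show ?thesis
      using ik j unfolding p_def by (auto simp: signed_mat_def Let_def)
  qed
  finally show "(signed_mat n g * signed_mat n h) $$ (i, k) = signed_mat n (h \<circ> g) $$ (i, k)" .
qed (simp_all add: signed_mat_def)

lemma signed_perm_comp:
  assumes "signed_perm n g" "signed_perm n h"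
  shows "signed_perm n (h \<circ> g)"
proof -
  have odd: "h (- p) = - h p" for p using assms(2) by (auto simp: signed_perm_def)
  have "bij_betw ((\<lambda>p. \<bar>h p\<bar>) \<circ> (\<lambda>p. \<bar>g p\<bar>)) {1..int n} {1..int n}"
    using assms unfolding signed_perm_def by (blast intro: bij_betw_trans)
  moreover have "(\<lambda>p. \<bar>h p\<bar>) \<circ> (\<lambda>p. \<bar>g p\<bar>) = (\<lambda>p. \<bar>(h \<circ> g) p\<bar>)"
  proof
    fix p show "((\<lambda>p. \<bar>h p\<bar>) \<circ> (\<lambda>p. \<bar>g p\<bar>)) p = \<bar>(h \<circ> g) p\<bar>"
      using odd[of "g p"] by (cases "g p \<ge> 0") auto
  qed
  ultimately show ?thesis
    using assms unfolding signed_perm_def by simp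
qed

section \<open>The product of the signs, and membership in W\<close>

definition sign_product :: "nat \<Rightarrow> (int \<Rightarrow> int) \<Rightarrow> int" where
  "sign_product n g = (\<Prod>p\<in>{1..int n}. sgn (g p))"

text \<open>The sign of \<open>h (g p)\<close> splits into the sign of \<open>g p\<close> and that
  of \<open>h\<close> at \<open>\<bar>g p\<bar>\<close>; the second factors are reindexed along the
  permutation sending \<open>p\<close> to \<open>\<bar>g p\<bar>\<close>.\<close>

lemma sign_product_comp:
  assumes "signed_perm n g" "signed_perm n h"
  shows "sign_product n (h \<circ> g) = sign_product n g * sign_product n h"
proof -
  have odd: "h (- p) = - h p" for p using assms(2) by (auto simp: signed_perm_def)
  have bij: "bij_betw (\<lambda>p. \<bar>g p\<bar>) {1..int n} {1..int n}"
    using assms(1) by (simp add: signed_perm_def)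
  have "sign_product n (h \<circ> g) = (\<Prod>p\<in>{1..int n}. sgn (g p) * sgn (h \<bar>g p\<bar>))"
    unfolding sign_product_def o_def by (intro prod.cong refl sgn_comp_odd odd)
  also have "\<dots> = sign_product n g * (\<Prod>p\<in>{1..int n}. sgn (h \<bar>g p\<bar>))"
    by (simp add: prod.distrib sign_product_def)
  also have "(\<Prod>p\<in>{1..int n}. sgn (h \<bar>g p\<bar>)) = sign_product n h"
    using prod.reindex_bij_betw[OF bij, of "\<lambda>p. sgn (h p)"] by (simp add: sign_product_def)
  finally show ?thesis .
qed

text \<open>The nonzero positions form the graph of a permutation and the nonzero entries are signs,
  so among the conditions defining W only the one on the product of the entries is left.\<close>

lemma signed_mat_in_type_D_iff:
  assumes "signed_perm n g"
  shows "signed_mat n g \<in> carrier (type_D n) \<longleftrightarrow> sign_product n g = 1"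
proof -
  have bij: "bij_betw (\<lambda>p. \<bar>g p\<bar>) {1..int n} {1..int n}"
    using assms(1) by (simp add: signed_perm_def)
  have shift: "bij_betw (\<lambda>i. int (Suc i)) {..<n} {1..int n}"
    by (rule bij_betw_byWitness[where f' = "\<lambda>p. nat (p - 1)"]) auto
  have unshift: "bij_betw (\<lambda>p. nat (p - 1)) {1..int n} {..<n}"
    by (rule bij_betw_byWitness[where f' = "\<lambda>i. int (Suc i)"]) auto
  \<comment> \<open>The underlying permutation, moved to the matrix indices, which start at
    \<open>0\<close>.\<close>
  define \<sigma> where "\<sigma> = (\<lambda>i. nat (\<bar>g (int (Suc i))\<bar> - 1))"
  have \<sigma>: "bij_betw \<sigma> {..<n} {..<n}"
    using bij_betw_trans[OF shift bij_betw_trans[OF bij unshift]]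
    by (simp add: \<sigma>_def o_def)
  have g: "\<bar>g (int (Suc i))\<bar> = int (Suc (\<sigma> i))" if "i < n" for i
    using signed_perm_abs_mem[OF assms, of "int (Suc i)"] that by (auto simp: \<sigma>_def)
  have entry: "signed_mat n g $$ (i, j) = (if j = \<sigma> i then sgn (g (int (Suc i))) else 0)"
    if "i < n" "j < n" for i j
    using that g[of i] by (auto simp: signed_mat_def Let_def)
  have nz: "sgn (g (int (Suc i))) \<noteq> 0" if "i < n" for i
    using g[OF that] by (auto simp: sgn_if)
  have \<sigma>_less: "\<sigma> i < n" if "i < n" for i using \<sigma> that by (auto simp: bij_betw_def)
  have entry_iff: "signed_mat n g $$ (i, j) \<noteq> 0 \<longleftrightarrow> j = \<sigma> i" if "i < n" "j < n" for i j
    using entry[OF that] nz[OF that(1)] by auto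
  have rows: "\<exists>!j. j < n \<and> signed_mat n g $$ (i, j) \<noteq> 0" if "i < n" for i
    using entry_iff that \<sigma>_less by blast
  have cols: "\<exists>!i. i < n \<and> signed_mat n g $$ (i, j) \<noteq> 0" if "j < n" for j
  proof -
    have "j \<in> \<sigma> ` {..<n}" using \<sigma> that by (simp add: bij_betw_def)
    then obtain i where i: "i < n" "\<sigma> i = j" by auto
    have uniq: "i' = i" if "i' < n" "\<sigma> i' = j" for i'
      using \<sigma> i that by (auto simp: bij_betw_def inj_on_def)
    show ?thesis
    proof (rule ex1I[of _ i])
      show "i < n \<and> signed_mat n g $$ (i, j) \<noteq> 0" using entry_iff[OF i(1) that] i by simp
      show "i' = i" if "i' < n \<and> signed_mat n g $$ (i', j) \<noteq> 0" for i'
        using that entry_iff[of i' j] \<open>j < n\<close> uniq[of i'] by simp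
    qed
  qed
  have vals: "signed_mat n g $$ (i, j) = 1 \<or> signed_mat n g $$ (i, j) = - 1"
    if "i < n" "j < n" "signed_mat n g $$ (i, j) \<noteq> 0" for i j
    using entry[OF that(1,2)] that by (auto simp: sgn_if split: if_splits)
  have "{(i, j). i < n \<and> j < n \<and> signed_mat n g $$ (i, j) \<noteq> 0} = (\<lambda>i. (i, \<sigma> i)) ` {..<n}"
    using entry_iff \<sigma>_less by auto
  then have "(\<Prod>(i, j) \<in> {(i, j). i < n \<and> j < n \<and> signed_mat n g $$ (i, j) \<noteq> 0}.
      signed_mat n g $$ (i, j)) = (\<Prod>i<n. signed_mat n g $$ (i, \<sigma> i))"
    by (simp add: prod.reindex inj_on_def)
  also have "\<dots> = (\<Prod>i<n. sgn (g (int (Suc i))))"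
    using entry \<sigma>_less by (intro prod.cong) auto
  also have "\<dots> = sign_product n g"
    using prod.reindex_bij_betw[OF shift, of "\<lambda>p. sgn (g p)"] by (simp add: sign_product_def)
  finally have prod: "(\<Prod>(i, j) \<in> {(i, j). i < n \<and> j < n \<and> signed_mat n g $$ (i, j) \<noteq> 0}.
      signed_mat n g $$ (i, j)) = sign_product n g" .
  show ?thesis
    unfolding type_D_def using rows cols vals prod by auto
qed

subsection \<open>Marked cycles as signed permutations\<close>

text \<open>The association list is the row rule of a marked cycle: \<open>rotate1\<close> pairs
  each entry with its cyclic successor, and the sign comes from the mark of the entry itself, not of
  its successor. The factor \<open>sgn p\<close> extends the table oddly to negative
  arguments.\<close>

definition cycle_action :: "int list \<Rightarrow> int \<Rightarrow> int" where
  "cycle_action xs p =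
     (case map_of (zip (map abs xs) (map2 (\<lambda>x y. sgn x * \<bar>y\<bar>) xs (rotate1 xs))) \<bar>p\<bar> of
        None \<Rightarrow> p | Some q \<Rightarrow> sgn p * q)"

lemma cycle_action_minus: "cycle_action xs (- p) = - cycle_action xs p"
proof -
  have "(case r of None \<Rightarrow> - p | Some q \<Rightarrow> sgn (- p) * q)
      = - (case r of None \<Rightarrow> p | Some q \<Rightarrow> sgn p * q)" for r
    by (cases r) auto
  then show ?thesis by (simp only: cycle_action_def abs_minus_cancel)
qed

lemma is_marked_cycle_nth:
  assumes "is_marked_cycle n xs" "a < length xs"
  shows "\<bar>xs ! a\<bar> \<in> {1..int n}" "xs ! a \<noteq> 0"
proof -
  show 1: "\<bar>xs ! a\<bar> \<in> {1..int n}"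
    using assms unfolding is_marked_cycle_def by (meson image_subset_iff nth_mem)
  then show "xs ! a \<noteq> 0" by auto
qed

lemma cycle_action_nth:
  assumes "is_marked_cycle n xs" "a < length xs"
  shows "cycle_action xs \<bar>xs ! a\<bar> = sgn (xs ! a) * \<bar>xs ! (Suc a mod length xs)\<bar>"
proof -
  have "map_of (zip (map abs xs) (map2 (\<lambda>x y. sgn x * \<bar>y\<bar>) xs (rotate1 xs))) (map abs xs ! a)
      = Some (map2 (\<lambda>x y. sgn x * \<bar>y\<bar>) xs (rotate1 xs) ! a)"
    using assms by (intro map_of_zip_nth) (auto simp: is_marked_cycle_def)
  then show ?thesis
    using assms is_marked_cycle_nth[OF assms]
    by (simp add: cycle_action_def nth_rotate1)
qed

lemma cycle_action_outside:
  assumes "\<bar>p\<bar> \<notin> abs ` set xs"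
  shows "cycle_action xs p = p"
proof -
  have "map_of (zip (map abs xs) (map2 (\<lambda>x y. sgn x * \<bar>y\<bar>) xs (rotate1 xs))) \<bar>p\<bar> = None"
    using assms by (subst map_of_zip_is_None) auto
  then show ?thesis by (simp only: cycle_action_def option.case)
qed

text \<open>On a finite set surjectivity suffices: a number in the cycle is reached from its cyclic
  predecessor, any other number from itself.\<close>

lemma signed_perm_cycle_action:
  assumes "is_marked_cycle n xs"
  shows "signed_perm n (cycle_action xs)"
proof -
  let ?A = "{1..int n}" and ?f = "\<lambda>p. \<bar>cycle_action xs p\<bar>"
  have sub: "?A \<subseteq> ?f ` ?A"
  proof
    fix q assume q: "q \<in> ?A"
    show "q \<in> ?f ` ?A"
    proof (cases "q \<in> abs ` set xs")
      case True
      then obtain b where b: "b < length xs" "q = \<bar>xs ! b\<bar>"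
        by (auto simp: in_set_conv_nth)
      \<comment> \<open>The cyclic predecessor of \<open>b\<close>; index \<open>0\<close> is
        preceded by the last index.\<close>
      define a where "a = (if b = 0 then length xs - 1 else b - 1)"
      have a: "a < length xs" "Suc a mod length xs = b" using b by (auto simp: a_def)
      have "?f \<bar>xs ! a\<bar> = q"
        using cycle_action_nth[OF assms a(1)] is_marked_cycle_nth[OF assms a(1)] a(2) b(2)
        by (simp add: abs_mult abs_sgn_eq)
      then show ?thesis using is_marked_cycle_nth(1)[OF assms a(1)] by (metis image_eqI)
    next
      case False
      then have "?f q = q" using q cycle_action_outside[of q xs] by auto
      then show ?thesis using q by (metis image_eqI)
    qed
  qed
  have "?f ` ?A = ?A"
    using card_seteq[OF _ sub] card_image_le[of ?A ?f] by auto
  moreover have "inj_on ?f ?A"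
    by (rule finite_surj_inj[OF _ sub]) simp
  ultimately show ?thesis
    by (simp add: signed_perm_def cycle_action_minus bij_betw_def)
qed

text \<open>Since the underlying numbers are distinct, only one index can satisfy the existential
  conditions for a given row, and the mark at that index decides between the entries
  \<open>1\<close> and \<open>- 1\<close>.\<close>

lemma marked_cycle_eq_signed_mat:
  assumes "is_marked_cycle n xs"
  shows "marked_cycle n xs = signed_mat n (cycle_action xs)"
proof (rule eq_matI)
  fix i j assume "i < dim_row (signed_mat n (cycle_action xs))"
    "j < dim_col (signed_mat n (cycle_action xs))"
  then have ij: "i < n" "j < n" by (simp_all add: signed_mat_def)
  define p q where "p = int (Suc i)" and "q = int (Suc j)"
  have p: "p > 0" "q > 0" by (simp_all add: p_def q_def)
  show "marked_cycle n xs $$ (i, j) = signed_mat n (cycle_action xs) $$ (i, j)"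
  proof (cases "p \<in> abs ` set xs")
    case True
    then obtain a where a: "a < length xs" "p = \<bar>xs ! a\<bar>"
      by (auto simp: in_set_conv_nth)
    let ?y = "\<bar>xs ! (Suc a mod length xs)\<bar>"
    have uniq: "b = a" if "b < length xs" "\<bar>xs ! b\<bar> = p" for b
      using assms that a nth_eq_iff_index_eq[of "map abs xs" a b]
      by (simp add: is_marked_cycle_def)
    have pos: "(\<exists>b<length xs. xs ! b = p \<and> \<bar>xs ! (Suc b mod length xs)\<bar> = q)
        \<longleftrightarrow> xs ! a > 0 \<and> ?y = q"
      using uniq a p by force
    have neg: "(\<exists>b<length xs. xs ! b = - p \<and> \<bar>xs ! (Suc b mod length xs)\<bar> = q)
        \<longleftrightarrow> xs ! a < 0 \<and> ?y = q"
      using uniq a p by force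
    have act: "cycle_action xs p = sgn (xs ! a) * ?y"
      using cycle_action_nth[OF assms a(1)] a(2) by simp
    have "Suc a mod length xs < length xs" using a by (intro mod_less_divisor) auto
    from is_marked_cycle_nth(2)[OF assms this] have "?y > 0" by simp
    then show ?thesis
      using ij True pos neg act p is_marked_cycle_nth(2)[OF assms a(1)]
      unfolding marked_cycle_def signed_mat_def Let_def p_def[symmetric] q_def[symmetric]
      by (simp add: p_def[symmetric] q_def[symmetric] sgn_if del: of_nat_Suc)
  next
    case False
    then have "\<not> (\<exists>b<length xs. xs ! b = p)" "\<not> (\<exists>b<length xs. xs ! b = - p)"
      using p nth_mem by (force simp: image_iff)+
    moreover have "cycle_action xs p = p" using False p cycle_action_outside[of p xs] by auto
    ultimately show ?thesis
      using ij False p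
      unfolding marked_cycle_def signed_mat_def Let_def
      by (auto simp: p_def[symmetric] q_def[symmetric] simp del: of_nat_Suc)
  qed
qed (simp_all add: marked_cycle_def signed_mat_def)

lemma marked_cycle_carrier [simp]: "marked_cycle n xs \<in> carrier_mat n n"
  by (simp add: marked_cycle_def)

text \<open>Numbers outside the cycle are fixed and contribute \<open>1\<close>; the row of an entry
  contributes the sign of that entry.\<close>

lemma sign_product_cycle_action:
  assumes "is_marked_cycle n xs"
  shows "sign_product n (cycle_action xs) = (-1) ^ length (filter (\<lambda>x. x < 0) xs)"
proof -
  have bij: "bij_betw (\<lambda>a. \<bar>xs ! a\<bar>) {..<length xs} (abs ` set xs)"
  proof -
    have "bij_betw ((!) (map abs xs)) {..<length (map abs xs)} (set (map abs xs))"
      using assms by (intro bij_betw_nth) (auto simp: is_marked_cycle_def)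
    moreover have "bij_betw ((!) (map abs xs)) {..<length xs} (abs ` set xs)
        = bij_betw (\<lambda>a. \<bar>xs ! a\<bar>) {..<length xs} (abs ` set xs)"
      by (rule bij_betw_cong) simp
    ultimately show ?thesis by simp
  qed
  have "sign_product n (cycle_action xs) = (\<Prod>p\<in>abs ` set xs. sgn (cycle_action xs p))"
    unfolding sign_product_def
    using assms by (intro prod.mono_neutral_right) (auto simp: is_marked_cycle_def cycle_action_outside)
  also have "\<dots> = (\<Prod>a<length xs. sgn (cycle_action xs \<bar>xs ! a\<bar>))"
    using prod.reindex_bij_betw[OF bij, of "\<lambda>p. sgn (cycle_action xs p)"] by simp
  also have "\<dots> = (\<Prod>a<length xs. sgn (xs ! a))"
  proof (rule prod.cong)
    fix a assume "a \<in> {..<length xs}"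
    then have a: "a < length xs" by simp
    then have "Suc a mod length xs < length xs" by (intro mod_less_divisor) auto
    then have "xs ! (Suc a mod length xs) \<noteq> 0" by (rule is_marked_cycle_nth(2)[OF assms])
    then show "sgn (cycle_action xs \<bar>xs ! a\<bar>) = sgn (xs ! a)"
      using cycle_action_nth[OF assms a] by (simp add: sgn_mult)
  qed simp
  also have "\<dots> = prod_list (map sgn xs)"
    by (simp add: prod.list_conv_set_nth atLeast0LessThan)
  also have "\<dots> = (-1) ^ length (filter (\<lambda>x. x < 0) xs)"
  proof -
    have "0 \<notin> set xs" using is_marked_cycle_nth(2)[OF assms] by (metis in_set_conv_nth)
    then show ?thesis by (induction xs) auto
  qed
  finally show ?thesis .
qed

text \<open>Turns the parity of the marks into a property of the matrix, so that it can be asserted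
  for every cycle notation of an element of W.\<close>

lemma marked_cycle_in_type_D_iff:
  assumes "is_marked_cycle n xs"
  shows "marked_cycle n xs \<in> carrier (type_D n) \<longleftrightarrow> even (length (filter (\<lambda>x. x < 0) xs))"
  using signed_mat_in_type_D_iff[OF signed_perm_cycle_action[OF assms]]
  by (simp add: marked_cycle_eq_signed_mat[OF assms] sign_product_cycle_action[OF assms]
      minus_one_power_iff)

section \<open>Rotation of marked cycles\<close>

lemma is_marked_cycle_rotate [simp]:
  "is_marked_cycle n (rotate k xs) \<longleftrightarrow> is_marked_cycle n xs"
  by (simp add: is_marked_cycle_def rotate_map[symmetric])

lemma marked_cycle_rotate1:
  assumes "is_marked_cycle n xs"
  shows "marked_cycle n (rotate1 xs) = marked_cycle n xs"
proof -
  have rot: "is_marked_cycle n (rotate1 xs)"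
    using is_marked_cycle_rotate[of n 1 xs] assms by simp
  have "cycle_action (rotate1 xs) p = cycle_action xs p" if p: "p \<in> {1..int n}" for p
  proof (cases "p \<in> abs ` set xs")
    case True
    then obtain b where b: "b < length xs" "p = \<bar>rotate1 xs ! b\<bar>"
      by (metis (no_types, lifting) image_iff in_set_conv_nth length_rotate1 set_rotate1)
    \<comment> \<open>Entry \<open>b\<close> of the rotated list is entry \<open>?c\<close> of
      \<open>xs\<close>, and both have the same cyclic successor.\<close>
    let ?c = "Suc b mod length xs"
    have c: "?c < length xs" using b by (intro mod_less_divisor) auto
    show ?thesis
      using cycle_action_nth[OF rot, of b] cycle_action_nth[OF assms, of ?c] b c
      by (simp add: nth_rotate1)
  next
    case False
    then show ?thesis using p by (simp add: cycle_action_outside)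
  qed
  then show ?thesis
    using signed_mat_cong by (metis marked_cycle_eq_signed_mat assms rot)
qed

lemma marked_cycle_rotate:
  assumes "is_marked_cycle n xs"
  shows "marked_cycle n (rotate k xs) = marked_cycle n xs"
proof (induction k)
  case (Suc k)
  then show ?case using marked_cycle_rotate1[of n "rotate k xs"] assms by simp
qed simp

text \<open>Serves two purposes: bringing the entries exchanged by a reflection to the front of
  their cycles, and making a cycle notation start with \<open>n\<close>.\<close>

lemma obtain_rotation_with_hd:
  assumes "p \<in> abs ` set xs"
  obtains k where "\<bar>hd (rotate k xs)\<bar> = p"
proof -
  obtain x where "x \<in> set xs" "p = \<bar>x\<bar>" using assms by auto
  moreover from this(1) obtain ys zs where "xs = ys @ x # zs" by (meson split_list)
  ultimately have "\<bar>hd (rotate (length ys) xs)\<bar> = p" by (simp add: rotate_append)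
  then show thesis by (rule that)
qed

subsection \<open>Merging two cycles\<close>

text \<open>Meant for \<open>s = 1\<close>, which changes nothing, and \<open>s = - 1\<close>, which
  changes the mark of the last entry. The one parameter covers both kinds of reflections.\<close>

definition mark_last :: "int \<Rightarrow> int list \<Rightarrow> int list" where
  "mark_last s xs = butlast xs @ [s * last xs]"

lemma length_mark_last [simp]: "xs \<noteq> [] \<Longrightarrow> length (mark_last s xs) = length xs"
  by (simp add: mark_last_def)

lemma mark_last_one [simp]: "xs \<noteq> [] \<Longrightarrow> mark_last 1 xs = xs"
  by (simp add: mark_last_def)

lemma nth_mark_last:
  assumes "a < length xs"
  shows "mark_last s xs ! a = (if Suc a = length xs then s * xs ! a else xs ! a)"
proof (cases "Suc a = length xs")
  case True
  then have "xs \<noteq> []" "length xs - 1 = a" by auto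
  then show ?thesis using True by (simp add: mark_last_def nth_append last_conv_nth)
next
  case False
  then have "a < length xs - 1" using assms by simp
  then show ?thesis using False by (simp add: mark_last_def nth_append nth_butlast)
qed

lemma map_abs_mark_last [simp]:
  assumes "xs \<noteq> []" "\<bar>s\<bar> = 1"
  shows "map abs (mark_last s xs) = map abs xs"
  using assms by (intro nth_equalityI) (auto simp: nth_mark_last abs_mult)

lemma is_marked_cycle_cong:
  assumes "map abs xs = map abs ys"
  shows "is_marked_cycle n xs \<longleftrightarrow> is_marked_cycle n ys"
  unfolding is_marked_cycle_def using assms by (metis list.set_map map_is_Nil_conv)

lemma even_negatives_mark_last:
  assumes "xs \<noteq> []" "0 \<notin> set xs"
  shows "even (length (filter (\<lambda>x. x < 0) (mark_last (- 1) xs)))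
    \<longleftrightarrow> odd (length (filter (\<lambda>x. x < 0) xs))"
proof -
  obtain ys y where "xs = ys @ [y]" using assms(1) by (metis append_butlast_last_id)
  then show ?thesis using assms(2) by (auto simp: mark_last_def)
qed

lemma cycle_action_pair:
  assumes "is_marked_cycle n [x, y]"
  shows "cycle_action [x, y] \<bar>x\<bar> = sgn x * \<bar>y\<bar>" "cycle_action [x, y] \<bar>y\<bar> = sgn y * \<bar>x\<bar>"
  using cycle_action_nth[OF assms, of 0] cycle_action_nth[OF assms, of 1] by simp_all

text \<open>The reflection acts last and moves only the heads of \<open>us\<close> and
  \<open>vs\<close>. Within the two cycles these values arise exactly at the last entries, each of
  which is redirected to the head of the other cycle with an additional sign
  \<open>s\<close>.\<close>

lemma cycle_action_merge:
  assumes cyc: "is_marked_cycle n (us @ vs)" and ne: "us \<noteq> []" "vs \<noteq> []" and s: "\<bar>s\<bar> = 1"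
    and p: "p > 0"
  shows "cycle_action [s * \<bar>hd us\<bar>, s * \<bar>hd vs\<bar>] (cycle_action vs (cycle_action us p))
    = cycle_action (mark_last s us @ mark_last s vs) p"
proof -
  let ?R = "[s * \<bar>hd us\<bar>, s * \<bar>hd vs\<bar>]" and ?W = "mark_last s us @ mark_last s vs"
  have usc: "is_marked_cycle n us" and vsc: "is_marked_cycle n vs"
    using cyc ne by (auto simp: is_marked_cycle_def)
  have Wabs: "map abs ?W = map abs (us @ vs)" using ne s by simp
  then have Wc: "is_marked_cycle n ?W" using cyc is_marked_cycle_cong by blast
  have disj: "abs ` set us \<inter> abs ` set vs = {}" using cyc by (auto simp: is_marked_cycle_def)
  have nzu: "u \<noteq> 0" if "u \<in> set us" for u
    using usc that by (auto simp: is_marked_cycle_def)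
  have nzv: "v \<noteq> 0" if "v \<in> set vs" for v
    using vsc that by (auto simp: is_marked_cycle_def)
  have hd: "hd us \<in> set us" "hd vs \<in> set vs" using ne by auto
  have hd0: "us ! 0 = hd us" "vs ! 0 = hd vs" using ne by (simp_all add: hd_conv_nth)
  have Rset: "abs ` set ?R = {\<bar>hd us\<bar>, \<bar>hd vs\<bar>}" using s by (simp add: abs_mult)
  have "\<bar>hd us\<bar> \<in> {1..int n}" "\<bar>hd vs\<bar> \<in> {1..int n}" "\<bar>hd us\<bar> \<noteq> \<bar>hd vs\<bar>"
    using usc vsc hd disj unfolding is_marked_cycle_def by blast+
  then have Rc: "is_marked_cycle n ?R" using s by (simp add: is_marked_cycle_def abs_mult)
  have sgns: "sgn s = s" "s * s = 1" using s by (auto simp: abs_if sgn_if split: if_splits)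
  have Ru: "cycle_action ?R \<bar>hd us\<bar> = s * \<bar>hd vs\<bar>" and Rv: "cycle_action ?R \<bar>hd vs\<bar> = s * \<bar>hd us\<bar>"
    using cycle_action_pair[OF Rc] s sgns nzu[OF hd(1)] nzv[OF hd(2)]
    by (simp_all add: abs_mult sgn_mult)
  \<comment> \<open>Oddness lets the sign produced by one action pass through the next.\<close>
  have odd: "cycle_action xs (sgn u * q) = sgn u * cycle_action xs q" if "u \<noteq> 0" for xs u q
    using that cycle_action_minus[of xs q] by (auto simp: sgn_if)
  consider (u) "p \<in> abs ` set us" | (v) "p \<in> abs ` set vs"
    | (out) "p \<notin> abs ` set us" "p \<notin> abs ` set vs" by blast
  then show ?thesis
  proof cases
    case u
    then obtain a where a: "a < length us" "p = \<bar>us ! a\<bar>" by (auto simp: in_set_conv_nth)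
    have nz: "us ! a \<noteq> 0" using a nzu by auto
    let ?b = "Suc a mod length us"
    have b: "?b < length us" using a by (intro mod_less_divisor) auto
    then have "\<bar>us ! ?b\<bar> \<notin> abs ` set vs" using disj by (metis disjoint_iff image_eqI nth_mem)
    then have "cycle_action vs \<bar>us ! ?b\<bar> = \<bar>us ! ?b\<bar>" by (simp add: cycle_action_outside)
    then have lhs: "cycle_action ?R (cycle_action vs (cycle_action us p))
        = sgn (us ! a) * cycle_action ?R \<bar>us ! ?b\<bar>"
      using cycle_action_nth[OF usc a(1)] a(2) odd[OF nz] by simp
    have Wa: "\<bar>?W ! a\<bar> = p" "a < length ?W"
      using a ne s by (auto simp: nth_append nth_mark_last abs_mult)
    note rhs = cycle_action_nth[OF Wc Wa(2), unfolded Wa(1)]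
    show ?thesis
    proof (cases "Suc a = length us")
      case True
      then have "?W ! (Suc a mod length ?W) = mark_last s vs ! 0"
        using ne a by (simp add: nth_append)
      \<comment> \<open>If \<open>vs\<close> is a singleton, its head is also its last entry and may
        change its mark; the successor enters only through its underlying number.\<close>
      then have "\<bar>?W ! (Suc a mod length ?W)\<bar> = \<bar>hd vs\<bar>"
        using ne s hd0 by (auto simp: nth_mark_last abs_mult)
      moreover have "?W ! a = s * us ! a" using True a ne by (simp add: nth_append nth_mark_last)
      moreover have "cycle_action ?R \<bar>us ! ?b\<bar> = s * \<bar>hd vs\<bar>" using True hd0 Ru by simp
      ultimately show ?thesis unfolding lhs rhs by (simp add: sgn_mult sgns)
    next
      case False
      then have sa: "Suc a < length us" using a by simp
      then have "\<bar>?W ! (Suc a mod length ?W)\<bar> = \<bar>us ! Suc a\<bar>"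
        using ne s by (simp add: nth_append nth_mark_last abs_mult)
      moreover have "?W ! a = us ! a" using sa ne by (simp add: nth_append nth_mark_last)
      \<comment> \<open>Before the end of \<open>us\<close> the successor is the head of neither
        cycle, so the reflection fixes it.\<close>
      moreover have "cycle_action ?R \<bar>us ! ?b\<bar> = \<bar>us ! Suc a\<bar>"
      proof -
        have "\<bar>us ! Suc a\<bar> \<noteq> \<bar>us ! 0\<bar>"
          using usc sa nth_eq_iff_index_eq[of "map abs us" "Suc a" 0]
          by (auto simp: is_marked_cycle_def)
        moreover have "\<bar>us ! Suc a\<bar> \<noteq> \<bar>hd vs\<bar>"
          using disj sa hd(2) by (metis disjoint_iff image_eqI nth_mem)
        ultimately have "\<bar>\<bar>us ! Suc a\<bar>\<bar> \<notin> abs ` set ?R" unfolding Rset using hd0 by simp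
        then show ?thesis using sa by (simp add: cycle_action_outside)
      qed
      ultimately show ?thesis unfolding lhs rhs by simp
    qed
  next
    case v
    then obtain a where a: "a < length vs" "p = \<bar>vs ! a\<bar>" by (auto simp: in_set_conv_nth)
    have nz: "vs ! a \<noteq> 0" using a nzv by auto
    let ?b = "Suc a mod length vs"
    have "p \<notin> abs ` set us" using v disj by auto
    then have "cycle_action us p = p" using p by (simp add: cycle_action_outside)
    then have lhs: "cycle_action ?R (cycle_action vs (cycle_action us p))
        = sgn (vs ! a) * cycle_action ?R \<bar>vs ! ?b\<bar>"
      using cycle_action_nth[OF vsc a(1)] a(2) odd[OF nz] by simp
    have Wa: "\<bar>?W ! (length us + a)\<bar> = p" "length us + a < length ?W"
      using a ne s by (auto simp: nth_append nth_mark_last abs_mult)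
    note rhs = cycle_action_nth[OF Wc Wa(2), unfolded Wa(1)]
    show ?thesis
    proof (cases "Suc a = length vs")
      case True
      \<comment> \<open>The last entry of \<open>vs\<close> closes the merged cycle: its successor
        is the head of \<open>us\<close>.\<close>
      then have "Suc (length us + a) = length ?W" using ne by simp
      then have "Suc (length us + a) mod length ?W = 0" by (simp only: mod_self)
      then have "?W ! (Suc (length us + a) mod length ?W) = mark_last s us ! 0"
        using ne by (simp add: nth_append)
      then have "\<bar>?W ! (Suc (length us + a) mod length ?W)\<bar> = \<bar>hd us\<bar>"
        using ne s hd0 by (auto simp: nth_mark_last abs_mult)
      moreover have "?W ! (length us + a) = s * vs ! a"
        using True a ne by (simp add: nth_append nth_mark_last)
      moreover have "cycle_action ?R \<bar>vs ! ?b\<bar> = s * \<bar>hd us\<bar>" using True hd0 Rv by simp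
      ultimately show ?thesis unfolding lhs rhs by (simp add: sgn_mult sgns)
    next
      case False
      then have sa: "Suc a < length vs" using a by simp
      then have "\<bar>?W ! (Suc (length us + a) mod length ?W)\<bar> = \<bar>vs ! Suc a\<bar>"
        using ne s by (simp add: nth_append nth_mark_last abs_mult)
      moreover have "?W ! (length us + a) = vs ! a" using sa ne by (simp add: nth_append nth_mark_last)
      moreover have "cycle_action ?R \<bar>vs ! ?b\<bar> = \<bar>vs ! Suc a\<bar>"
      proof -
        have "\<bar>vs ! Suc a\<bar> \<noteq> \<bar>vs ! 0\<bar>"
          using vsc sa nth_eq_iff_index_eq[of "map abs vs" "Suc a" 0]
          by (auto simp: is_marked_cycle_def)
        moreover have "\<bar>vs ! Suc a\<bar> \<noteq> \<bar>hd us\<bar>"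
          using disj sa hd(1) by (metis disjoint_iff image_eqI nth_mem)
        ultimately have "\<bar>\<bar>vs ! Suc a\<bar>\<bar> \<notin> abs ` set ?R" unfolding Rset using hd0 by simp
        then show ?thesis using sa by (simp add: cycle_action_outside)
      qed
      ultimately show ?thesis unfolding lhs rhs by simp
    qed
  next
    case out
    have "abs ` set ?W = abs ` set us \<union> abs ` set vs"
      using Wabs by (metis image_Un list.set_map set_append)
    moreover have "p \<notin> abs ` set ?R" unfolding Rset using out hd by auto
    ultimately show ?thesis using out p by (simp add: cycle_action_outside)
  qed
qed

lemma marked_cycle_merge:
  assumes cyc: "is_marked_cycle n (us @ vs)" and ne: "us \<noteq> []" "vs \<noteq> []" and s: "\<bar>s\<bar> = 1"
  shows "marked_cycle n us * marked_cycle n vs * marked_cycle n [s * \<bar>hd us\<bar>, s * \<bar>hd vs\<bar>]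
      = marked_cycle n (mark_last s us @ mark_last s vs)"
    and "is_marked_cycle n (mark_last s us @ mark_last s vs)"
proof -
  let ?R = "[s * \<bar>hd us\<bar>, s * \<bar>hd vs\<bar>]"
  have usc: "is_marked_cycle n us" and vsc: "is_marked_cycle n vs"
    using cyc ne by (auto simp: is_marked_cycle_def)
  have "abs ` set us \<inter> abs ` set vs = {}" using cyc by (auto simp: is_marked_cycle_def)
  then have "\<bar>hd us\<bar> \<in> {1..int n}" "\<bar>hd vs\<bar> \<in> {1..int n}" "\<bar>hd us\<bar> \<noteq> \<bar>hd vs\<bar>"
    using usc vsc hd_in_set[OF ne(1)] hd_in_set[OF ne(2)] unfolding is_marked_cycle_def by blast+
  then have Rc: "is_marked_cycle n ?R" using s by (simp add: is_marked_cycle_def abs_mult)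
  have "map abs (mark_last s us @ mark_last s vs) = map abs (us @ vs)" using ne s by simp
  then show Wc: "is_marked_cycle n (mark_last s us @ mark_last s vs)"
    using cyc is_marked_cycle_cong by blast
  note perms = signed_perm_cycle_action[OF usc] signed_perm_cycle_action[OF vsc]
    signed_perm_cycle_action[OF Rc]
  have "marked_cycle n us * marked_cycle n vs * marked_cycle n ?R
      = signed_mat n (cycle_action ?R \<circ> (cycle_action vs \<circ> cycle_action us))"
    by (simp only: marked_cycle_eq_signed_mat usc vsc Rc signed_mat_mult perms signed_perm_comp)
  also have "\<dots> = signed_mat n (cycle_action (mark_last s us @ mark_last s vs))"
    using cycle_action_merge[OF cyc ne s] by (intro signed_mat_cong) simp
  finally show "marked_cycle n us * marked_cycle n vs * marked_cycle n ?R
      = marked_cycle n (mark_last s us @ mark_last s vs)"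
    by (simp only: marked_cycle_eq_signed_mat[OF Wc])
qed

text \<open>Supplies the trivial first factor when a type I step is read as a merge, and the end of
  the procedure.\<close>

lemma marked_cycle_singleton:
  assumes "x > 0"
  shows "marked_cycle n [x] = 1\<^sub>m n"
proof (rule eq_matI)
  fix i j assume "i < dim_row (1\<^sub>m n :: int mat)" "j < dim_col (1\<^sub>m n :: int mat)"
  then show "marked_cycle n [x] $$ (i, j) = 1\<^sub>m n $$ (i, j)"
    using assms by (cases "i = j"; cases "x = int (Suc i)")
      (simp_all add: marked_cycle_def Let_def Ex_less_Suc del: of_nat_Suc)
qed (simp_all add: marked_cycle_def)

subsection \<open>The type I procedure\<close>

text \<open>Merging the trivial cycle \<open>[\<bar>x\<bar>]\<close> with the cycle left after the
  step restores the cycle before it. In this direction the step is a factorization and no inverses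
  occur.\<close>

lemma marked_cycle_type_I_step:
  assumes cyc: "is_marked_cycle n (x # xs)" and ne: "xs \<noteq> []"
  shows "marked_cycle n (mark_last (sgn x) xs) * marked_cycle n [sgn x * \<bar>x\<bar>, sgn x * \<bar>hd xs\<bar>]
      = marked_cycle n (x # xs)"
    and "is_marked_cycle n (mark_last (sgn x) xs)"
proof -
  let ?ys = "mark_last (sgn x) xs"
  have x: "x \<noteq> 0" using cyc by (auto simp: is_marked_cycle_def)
  then have s: "\<bar>sgn x\<bar> = 1" by (simp add: abs_sgn_eq)
  have ys: "?ys \<noteq> []" by (simp add: mark_last_def)
  have abs_ys: "map abs ?ys = map abs xs" using ne s by simp
  have "is_marked_cycle n ([\<bar>x\<bar>] @ ?ys)"
    using cyc is_marked_cycle_cong[of "[\<bar>x\<bar>] @ ?ys" "x # xs"] abs_ys by simp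
  note merge = marked_cycle_merge[OF this _ ys s]
  have "\<bar>hd ?ys\<bar> = \<bar>hd xs\<bar>"
    using abs_ys ne ys by (metis hd_map)
  \<comment> \<open>Marking twice with the same sign cancels, because
    \<open>sgn x * sgn x = 1\<close>.\<close>
  moreover have "mark_last (sgn x) ?ys = xs"
    using ne x by (simp add: mark_last_def mult.assoc[symmetric] sgn_mult[symmetric] del: sgn_mult)
  moreover have "mark_last (sgn x) [\<bar>x\<bar>] = [x]" by (simp add: mark_last_def sgn_mult_abs)
  ultimately show "marked_cycle n ?ys * marked_cycle n [sgn x * \<bar>x\<bar>, sgn x * \<bar>hd xs\<bar>]
      = marked_cycle n (x # xs)"
    using merge(1) x by (simp add: marked_cycle_singleton left_mult_one_mat[of _ n n])
  have "is_marked_cycle n xs" using cyc ne by (auto simp: is_marked_cycle_def)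
  then show "is_marked_cycle n ?ys" using is_marked_cycle_cong[OF abs_ys] by simp
qed

text \<open>Joins the two branches of the recursion into one formula in \<open>sgn x\<close>, the
  form in which merging applies.\<close>

lemma type_I_reflections_step:
  assumes "x \<noteq> 0"
  shows "type_I_reflections n (x # y # zs) =
    marked_cycle n [sgn x * \<bar>x\<bar>, sgn x * \<bar>y\<bar>] # type_I_reflections n (mark_last (sgn x) (y # zs))"
proof (cases "x > 0")
  case True
  then show ?thesis by simp
next
  case False
  then show ?thesis using assms by (simp add: mark_last_def)
qed

section \<open>Ordered products of the reflections in the procedure\<close>

lemma list_product_type_D_carrier:
  assumes "set ts \<subseteq> carrier_mat n n"
  shows "list_product (type_D n) ts \<in> carrier_mat n n"
  using assms by (induction ts) (auto simp: list_product_def type_D_def)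

text \<open>\<open>list_product\<close> unfolds at the left end, whereas in the reversed list the
  first reflection of the procedure stands at the right end.\<close>

lemma list_product_type_D_snoc:
  assumes "set ts \<subseteq> carrier_mat n n" "t \<in> carrier_mat n n"
  shows "list_product (type_D n) (ts @ [t]) = list_product (type_D n) ts * t"
  using assms(1)
proof (induction ts)
  case Nil
  then show ?case using assms(2) by (simp add: list_product_def type_D_def)
next
  case (Cons u ts)
  have "list_product (type_D n) ts \<in> carrier_mat n n"
    using Cons.prems by (intro list_product_type_D_carrier) auto
  moreover have "list_product (type_D n) (us) = foldr (*) us (1\<^sub>m n)" for us
    by (simp add: list_product_def type_D_def)
  ultimately show ?case
    using Cons assms(2) assoc_mult_mat[of u n n "list_product (type_D n) ts" n t n] by simp
qed

lemma reflection_mem: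
  assumes "is_marked_cycle n [x, y]" "\<bar>s\<bar> = 1"
  shows "marked_cycle n [s * \<bar>x\<bar>, s * \<bar>y\<bar>] \<in> reflections n"
proof -
  have "s = 1 \<or> s = - 1" using assms(2) by auto
  moreover have "\<bar>x\<bar> \<in> {1..int n}" "\<bar>y\<bar> \<in> {1..int n}" "\<bar>x\<bar> \<noteq> \<bar>y\<bar>"
    using assms(1) by (auto simp: is_marked_cycle_def)
  ultimately show ?thesis unfolding reflections_def by fastforce
qed

lemma reflections_carrier_mat: "reflections n \<subseteq> carrier_mat n n"
  by (auto simp: reflections_def)

lemma set_type_I_reflections:
  assumes "is_marked_cycle n xs"
  shows "set (type_I_reflections n xs) \<subseteq> reflections n"
  using assms
proof (induction "length xs" arbitrary: xs)
  case (Suc l)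
  show ?case
  proof (cases "\<exists>x y zs. xs = x # y # zs")
    case True
    then obtain x y zs where xs: "xs = x # y # zs" by blast
    have x: "x \<noteq> 0" using Suc.prems xs by (auto simp: is_marked_cycle_def)
    have "marked_cycle n [sgn x * \<bar>x\<bar>, sgn x * \<bar>y\<bar>] \<in> reflections n"
      using Suc.prems xs x by (intro reflection_mem) (auto simp: is_marked_cycle_def abs_sgn_eq)
    moreover have "set (type_I_reflections n (mark_last (sgn x) (y # zs))) \<subseteq> reflections n"
      using Suc.hyps marked_cycle_type_I_step(2)[of n x "y # zs"] Suc.prems xs by simp
    ultimately show ?thesis using xs x by (simp add: type_I_reflections_step del: type_I_reflections.simps)
  next
    case False
    then have "type_I_reflections n xs = []" by (metis list.exhaust type_I_reflections.simps(2,3))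
    then show ?thesis by simp
  qed
qed simp

text \<open>By induction the later reflections multiply to the cycle left after the first step, and
  the first reflection on the right restores the given cycle. The induction is on the length because
  the recursive call may change a mark in the tail.\<close>

lemma list_product_type_I_reflections:
  assumes "is_marked_cycle n xs" "even (length (filter (\<lambda>x. x < 0) xs))"
  shows "list_product (type_D n) (rev (type_I_reflections n xs)) = marked_cycle n xs"
  using assms
proof (induction "length xs" arbitrary: xs)
  case 0
  then show ?case by (simp add: is_marked_cycle_def)
next
  case (Suc l)
  have nz: "0 \<notin> set xs" using Suc.prems(1) by (force simp: is_marked_cycle_def)
  show ?case
  proof (cases "\<exists>x y zs. xs = x # y # zs")
    case True
    then obtain x y zs where xs: "xs = x # y # zs" by blast
    define us where "us = mark_last (sgn x) (y # zs)"
    let ?R = "marked_cycle n [sgn x * \<bar>x\<bar>, sgn x * \<bar>y\<bar>]"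
    have x: "x \<noteq> 0" using nz xs by auto
    have us: "is_marked_cycle n us" "marked_cycle n us * ?R = marked_cycle n xs"
      using marked_cycle_type_I_step[of n x "y # zs"] Suc.prems(1) xs by (auto simp: us_def)
    \<comment> \<open>Dropping an overlined \<open>x\<close> loses one mark, and the simultaneous
      change at the last entry corrects the parity.\<close>
    have "even (length (filter (\<lambda>x. x < 0) us))"
    proof (cases "x > 0")
      case True
      then show ?thesis using Suc.prems(2) xs by (simp add: us_def)
    next
      case False
      then have "sgn x = - 1" "x < 0" using x by auto
      then show ?thesis
        using even_negatives_mark_last[of "y # zs"] nz Suc.prems(2) unfolding us_def xs
        by (simp split: if_splits)
    qed
    then have IH: "list_product (type_D n) (rev (type_I_reflections n us)) = marked_cycle n us"
      using Suc.hyps us(1) xs by (simp add: us_def)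
    have "set (rev (type_I_reflections n us)) \<subseteq> carrier_mat n n"
      using set_type_I_reflections[OF us(1)] reflections_carrier_mat by auto
    then have "list_product (type_D n) (rev (type_I_reflections n xs)) = marked_cycle n us * ?R"
      unfolding xs type_I_reflections_step[OF x] us_def[symmetric] rev.simps IH[symmetric]
      by (intro list_product_type_D_snoc) auto
    then show ?thesis using us by simp
  next
    case False
    then obtain x where xs: "xs = [x]" using Suc.hyps(2) by (metis length_Suc_conv list.exhaust)
    \<comment> \<open>Even parity excludes an overlined \<open>1\<close>-cycle, so what is left is
      the identity, the empty product.\<close>
    then have "x > 0" using Suc.prems(2) nz by (auto split: if_splits)
    then show ?thesis using xs by (simp add: marked_cycle_singleton list_product_def type_D_def)
  qed
qed

subsection \<open>The lower bound on the reflection length\<close>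

lemma marked_cycle_pair_nonzero:
  assumes "i \<noteq> j" "i \<noteq> 0" "j \<noteq> 0" "p < n" "q < n" "marked_cycle n [i, j] $$ (p, q) \<noteq> 0"
  shows "p = q \<or> {int (Suc p), int (Suc q)} = {\<bar>i\<bar>, \<bar>j\<bar>}"
proof -
  have ex: "(\<exists>a<length [i, j]. P a) \<longleftrightarrow> P 0 \<or> P 1" for P
    by (simp add: Ex_less_Suc2)
  show ?thesis
    using assms(4-6) unfolding marked_cycle_def Let_def ex
    by (auto simp del: of_nat_Suc split: if_splits)
qed

text \<open>Here \<open>f\<close> labels the connected components of the graph on the rows whose edges are the
  transpositions underlying \<open>ts\<close>; adding an edge merges at most two components.\<close>

lemma reflection_product_components:
  assumes "set ts \<subseteq> reflections n"
  shows "\<exists>f :: nat \<Rightarrow> nat. n \<le> card (f ` {..<n}) + length ts \<and>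
    (\<forall>p<n. \<forall>q<n. list_product (type_D n) ts $$ (p, q) \<noteq> 0 \<longrightarrow> f p = f q)"
  using assms
proof (induction ts)
  case Nil
  show ?case
    \<comment> \<open>The identity matrix connects no two distinct rows, so every row keeps its own
      label.\<close>
    by (intro exI[of _ id]) (auto simp: list_product_def type_D_def split: if_splits)
next
  case (Cons t ts)
  then obtain f :: "nat \<Rightarrow> nat" where f: "n \<le> card (f ` {..<n}) + length ts"
    "\<And>p q. p < n \<Longrightarrow> q < n \<Longrightarrow> list_product (type_D n) ts $$ (p, q) \<noteq> 0 \<Longrightarrow> f p = f q"
    by auto
  have "t \<in> reflections n" using Cons.prems by simp
  then obtain i j where ij: "i \<noteq> j" "i \<in> {1..int n}" "j \<in> {1..int n}"
    "t = marked_cycle n [i, j] \<or> t = marked_cycle n [- i, - j]"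
    by (auto simp: reflections_def)
  define a b where "a = nat (i - 1)" and "b = nat (j - 1)"
  have ab: "i = int (Suc a)" "j = int (Suc b)" using ij by (auto simp: a_def b_def)
  have t: "p = q \<or> {p, q} = {a, b}" if "p < n" "q < n" "t $$ (p, q) \<noteq> 0" for p q
    using ij(4)
  proof
    assume "t = marked_cycle n [i, j]"
    then show ?thesis
      using marked_cycle_pair_nonzero[of i j p n q] that ij by (auto simp: ab doubleton_eq_iff)
  next
    assume "t = marked_cycle n [- i, - j]"
    then show ?thesis
      using marked_cycle_pair_nonzero[of "- i" "- j" p n q] that ij
      by (auto simp: ab doubleton_eq_iff)
  qed
  \<comment> \<open>The class of \<open>b\<close> receives the label of the class of
    \<open>a\<close>, so at most the label \<open>f b\<close> is lost.\<close>
  define g where "g = (\<lambda>p. if f p = f b then f a else f p)"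
  have "f ` {..<n} \<subseteq> insert (f b) (g ` {..<n})" by (auto simp: g_def)
  then have "card (f ` {..<n}) \<le> card (insert (f b) (g ` {..<n}))" by (intro card_mono) auto
  also have "\<dots> \<le> Suc (card (g ` {..<n}))" by (simp add: card_insert_if)
  finally have card: "n \<le> card (g ` {..<n}) + length (t # ts)" using f(1) by simp
  have tc: "t \<in> carrier_mat n n" "list_product (type_D n) ts \<in> carrier_mat n n"
    using Cons.prems reflections_carrier_mat by (auto intro!: list_product_type_D_carrier)
  have "g p = g q" if pq: "p < n" "q < n" "list_product (type_D n) (t # ts) $$ (p, q) \<noteq> 0" for p q
  proof -
    have "list_product (type_D n) (t # ts) = t * list_product (type_D n) ts"
      by (simp add: list_product_def type_D_def)
    then have "list_product (type_D n) (t # ts) $$ (p, q)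
        = (\<Sum>r\<in>{0..<n}. t $$ (p, r) * list_product (type_D n) ts $$ (r, q))"
      using tc pq by (simp add: scalar_prod_def)
    \<comment> \<open>A nonzero entry of the product needs a nonzero summand: from \<open>p\<close>
      to \<open>r\<close> by the edge of \<open>t\<close> or by \<open>p = r\<close>, then from
      \<open>r\<close> to \<open>q\<close> within a class of \<open>f\<close>.\<close>
    then obtain r where r: "r < n" "t $$ (p, r) \<noteq> 0" "list_product (type_D n) ts $$ (r, q) \<noteq> 0"
      using pq(3) by (metis (no_types, lifting) atLeastLessThan_iff mult_eq_0_iff sum.neutral)
    have "f r = f q" using f(2) r pq by simp
    moreover have "g p = g r" using t[of p r] r pq by (auto simp: g_def doubleton_eq_iff)
    ultimately show ?thesis by (simp add: g_def)
  qed
  then show ?case using card by blast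
qed

text \<open>The labels are constant along the cycle, which visits all \<open>n\<close> rows; hence
  there is a single class and the component bound reads
  \<open>n \<le> 1 + length ts\<close>.\<close>

lemma full_cycle_reflection_length:
  assumes cyc: "is_marked_cycle n xs" and len: "length xs = n"
    and ts: "set ts \<subseteq> reflections n" "list_product (type_D n) ts = marked_cycle n xs"
  shows "n - 1 \<le> length ts"
proof -
  obtain f :: "nat \<Rightarrow> nat" where f: "n \<le> card (f ` {..<n}) + length ts"
    "\<And>p q. p < n \<Longrightarrow> q < n \<Longrightarrow> marked_cycle n xs $$ (p, q) \<noteq> 0 \<Longrightarrow> f p = f q"
    using reflection_product_components[OF ts(1)] ts(2) by auto
  define idx where "idx = (\<lambda>a. nat (\<bar>xs ! a\<bar> - 1))"
  have idx: "idx a < n" "\<bar>xs ! a\<bar> = int (Suc (idx a))" if "a < n" for a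
    using is_marked_cycle_nth(1)[OF cyc, of a] that len by (auto simp: idx_def)
  \<comment> \<open>Consecutive entries of the cycle give a nonzero matrix entry whatever the mark,
    so their rows lie in one class.\<close>
  have step: "f (idx (Suc a)) = f (idx a)" if a: "Suc a < n" for a
  proof -
    have "xs ! a = int (Suc (idx a)) \<or> xs ! a = - int (Suc (idx a))"
      using idx(2)[of a] a by (auto simp: abs_if split: if_splits)
    moreover have "\<bar>xs ! (Suc a mod length xs)\<bar> = int (Suc (idx (Suc a)))"
      using a len idx(2)[of "Suc a"] by simp
    ultimately have "marked_cycle n xs $$ (idx a, idx (Suc a)) \<noteq> 0"
      using idx(1)[of a] idx(1)[of "Suc a"] a len
      unfolding marked_cycle_def Let_def by (auto simp del: of_nat_Suc)
    then show ?thesis using f(2)[of "idx a" "idx (Suc a)"] idx(1)[of a] idx(1)[of "Suc a"] a by simp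
  qed
  have const: "f (idx a) = f (idx 0)" if "a < n" for a
    using that by (induction a) (auto simp: step)
  \<comment> \<open>By counting: \<open>n\<close> distinct numbers exhaust a set of \<open>n\<close>
    elements.\<close>
  have "set (map abs xs) = {1..int n}"
  proof (rule card_seteq)
    show "set (map abs xs) \<subseteq> {1..int n}" using cyc by (simp add: is_marked_cycle_def)
    show "card {1..int n} \<le> card (set (map abs xs))"
      using cyc len distinct_card[of "map abs xs"] by (simp add: is_marked_cycle_def)
  qed simp
  then have "f p = f (idx 0)" if "p < n" for p
  proof -
    have "int (Suc p) \<in> set (map abs xs)" using that \<open>set (map abs xs) = {1..int n}\<close> by simp
    then obtain a where "a < n" "\<bar>xs ! a\<bar> = int (Suc p)" using len by (auto simp: in_set_conv_nth)
    then show ?thesis using const idx(2) by (metis of_nat_eq_iff nat.inject)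
  qed
  then have "f ` {..<n} \<subseteq> {f (idx 0)}" by auto
  then have "card (f ` {..<n}) \<le> 1" using card_mono[of "{f (idx 0)}"] by fastforce
  then show ?thesis using f(1) by simp
qed

section \<open>Reducedness and the final statement\<close>

lemma reduced_decomposition_type_I:
  assumes "is_marked_cycle n xs" "length xs = n" "even (length (filter (\<lambda>x. x < 0) xs))"
  shows "reduced_decomposition (type_D n) (reflections n) (marked_cycle n xs)
    (rev (type_I_reflections n xs))"
proof -
  \<comment> \<open>The procedure attains \<open>n - 1\<close>, and transitivity of the full cycle
    excludes fewer reflections.\<close>
  have "word_length (type_D n) (reflections n) (marked_cycle n xs) = n - 1"
    unfolding word_length_def
  proof (rule Least_equality)
    show "\<exists>ts. set ts \<subseteq> reflections n \<and> length ts = n - 1 \<and>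
        list_product (type_D n) ts = marked_cycle n xs"
      using assms set_type_I_reflections[OF assms(1)] list_product_type_I_reflections[OF assms(1,3)]
      by (intro exI[of _ "rev (type_I_reflections n xs)"]) (simp add: length_type_I_reflections)
  qed (use full_cycle_reflection_length[OF assms(1,2)] in blast)
  then show ?thesis
    using assms set_type_I_reflections[OF assms(1)] list_product_type_I_reflections[OF assms(1,3)]
    by (simp add: reduced_decomposition_def length_type_I_reflections)
qed

text \<open>The procedure works on a list rather than on a matrix, hence the quantification over
  cycle notations; the existence of one with \<open>n\<close> entries keeps that claim from being
  vacuous.\<close>

theorem proposition4p4:
  fixes n m i j :: nat and w w\<^sub>0 :: "int mat"
  assumes n: "n \<ge> 4"
    and m: "1 \<le> m" "m \<le> n div 2"
    and w: "w = marked_cycle n (rev [2..int m] @ [- 1])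
              \<otimes>\<^bsub>type_D n\<^esub> marked_cycle n (rev [int m + 2..int n] @ [- (int m + 1)])"
    and ij: "1 \<le> i" "i \<le> m" "m + 1 \<le> j" "j \<le> n"
    and w\<^sub>0: "w\<^sub>0 = w \<otimes>\<^bsub>type_D n\<^esub> marked_cycle n [int i, int j] \<or>
             w\<^sub>0 = w \<otimes>\<^bsub>type_D n\<^esub> marked_cycle n [- int i, - int j]"
  shows "w \<in> carrier (type_D n) \<and>
    (\<exists>xs. length xs = n \<and> is_cycle_notation n w\<^sub>0 xs) \<and>
    (\<forall>xs. length xs = n \<and> is_cycle_notation n w\<^sub>0 xs \<longrightarrow>
       even (length (filter (\<lambda>x. x < 0) xs)) \<and>
       reduced_decomposition (type_D n) (reflections n) w\<^sub>0 (rev (type_I_reflections n xs)))"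
proof -
  have mult: "A \<otimes>\<^bsub>type_D n\<^esub> B = A * B" for A B by (simp add: type_D_def)
  define us where "us = rev [2..int m] @ [- 1]"
  define vs where "vs = rev [int m + 2..int n] @ [- (int m + 1)]"
  have mn: "m < n" using n m by simp
  have abs_us: "map abs us = rev [1..int m]"
  proof -
    have "map abs [2..int m] = [2..int m]" by (rule map_idI) auto
    moreover have "[1..int m] = 1 # [2..int m]" using m(1) upto_rec1[of 1 "int m"] by simp
    ultimately show ?thesis by (simp add: us_def rev_map[symmetric])
  qed
  have abs_vs: "map abs vs = rev [int m + 1..int n]"
  proof -
    have "map abs [int m + 2..int n] = [int m + 2..int n]" by (rule map_idI) auto
    moreover have "[int m + 1..int n] = (int m + 1) # [int m + 2..int n]"
      using mn upto_rec1[of "int m + 1" "int n"] by (simp add: add.assoc)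
    ultimately show ?thesis by (simp add: vs_def rev_map[symmetric])
  qed
  \<comment> \<open>The underlying numbers of the two cycles split \<open>{1..int n}\<close> at
    \<open>m\<close>, so \<open>i\<close> and \<open>j\<close> lie in different cycles.\<close>
  have set_us: "abs ` set us = {1..int m}" and set_vs: "abs ` set vs = {int m + 1..int n}"
    using arg_cong[OF abs_us, of set] arg_cong[OF abs_vs, of set] by simp_all
  have dist: "distinct (map abs us)" "distinct (map abs vs)" unfolding abs_us abs_vs by simp_all
  have len: "length us + length vs = n"
    using arg_cong[OF abs_us, of length] arg_cong[OF abs_vs, of length] mn by simp
  have ne: "us \<noteq> []" "vs \<noteq> []" by (simp_all add: us_def vs_def)
  have usc: "is_marked_cycle n us" and vsc: "is_marked_cycle n vs"
    using dist ne set_us set_vs mn by (auto simp: is_marked_cycle_def)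
  have w': "w = marked_cycle n us * marked_cycle n vs" using w by (simp add: mult us_def vs_def)
  have negs: "filter (\<lambda>x. x < 0) us = [- 1]" "filter (\<lambda>x. x < 0) vs = [- (int m + 1)]"
    by (auto simp: us_def vs_def filter_empty_conv)
  note perms = signed_perm_cycle_action[OF usc] signed_perm_cycle_action[OF vsc]
  have w_mat: "w = signed_mat n (cycle_action vs \<circ> cycle_action us)"
    by (simp only: w' marked_cycle_eq_signed_mat usc vsc signed_mat_mult perms)
  have w_perm: "signed_perm n (cycle_action vs \<circ> cycle_action us)"
    using perms by (rule signed_perm_comp)
  \<comment> \<open>Each of the two cycles has exactly one overlined entry, and the two signs
    cancel.\<close>
  have w_sign: "sign_product n (cycle_action vs \<circ> cycle_action us) = 1"
    by (simp add: sign_product_comp perms sign_product_cycle_action usc vsc negs)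
  have w_carrier: "w \<in> carrier (type_D n)"
    using signed_mat_in_type_D_iff[OF w_perm] w_mat w_sign by simp
  \<comment> \<open>The sign \<open>s\<close> treats the plain and the overlined reflection
    together.\<close>
  obtain s where s: "\<bar>s\<bar> = 1" "s = 1 \<or> s = - 1" "w\<^sub>0 = w * marked_cycle n [s * int i, s * int j]"
    using w\<^sub>0 by (auto simp: mult intro: that[of 1] that[of "- 1"])
  have Rc: "is_marked_cycle n [s * int i, s * int j]"
    using s(1) ij by (auto simp: is_marked_cycle_def abs_mult)
  note R_perm = signed_perm_cycle_action[OF Rc]
  have w0_mat: "w\<^sub>0 = signed_mat n
      (cycle_action [s * int i, s * int j] \<circ> (cycle_action vs \<circ> cycle_action us))"
    by (simp only: s(3) w_mat marked_cycle_eq_signed_mat[OF Rc] signed_mat_mult w_perm R_perm)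
  have "sign_product n (cycle_action [s * int i, s * int j]) = 1"
    using s(2) ij by (auto simp: sign_product_cycle_action[OF Rc])
  then have w0_carrier: "w\<^sub>0 \<in> carrier (type_D n)"
    unfolding w0_mat signed_mat_in_type_D_iff[OF signed_perm_comp[OF w_perm R_perm]]
    by (simp add: sign_product_comp[OF w_perm R_perm] w_sign)
  have "\<exists>xs. length xs = n \<and> is_cycle_notation n w\<^sub>0 xs"
  proof -
    \<comment> \<open>Merging needs the reflection to exchange the first entries, so the cycles are
      rotated to start at \<open>i\<close> and \<open>j\<close>.\<close>
    obtain k where k: "\<bar>hd (rotate k us)\<bar> = int i"
      by (rule obtain_rotation_with_hd[of "int i" us]) (use set_us ij in auto)
    obtain l where l: "\<bar>hd (rotate l vs)\<bar> = int j"
      by (rule obtain_rotation_with_hd[of "int j" vs]) (use set_vs ij in auto)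
    define us' vs' where "us' = rotate k us" and "vs' = rotate l vs"
    have ne': "us' \<noteq> []" "vs' \<noteq> []" using ne by (simp_all add: us'_def vs'_def)
    have sets: "abs ` set us' = {1..int m}" "abs ` set vs' = {int m + 1..int n}"
      using set_us set_vs by (simp_all add: us'_def vs'_def)
    have "is_marked_cycle n us'" "is_marked_cycle n vs'" using usc vsc by (simp_all add: us'_def vs'_def)
    moreover have "abs ` set us' \<inter> abs ` set vs' = {}" unfolding sets by auto
    ultimately have cyc: "is_marked_cycle n (us' @ vs')"
      by (auto simp: is_marked_cycle_def)
    define ys where "ys = mark_last s us' @ mark_last s vs'"
    note merge = marked_cycle_merge[OF cyc ne' s(1), folded ys_def]
    have "w\<^sub>0 = marked_cycle n ys"
      using merge(1) k l usc vsc
      by (simp add: s(3) w' us'_def vs'_def marked_cycle_rotate)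
    have "map abs ys = map abs us' @ map abs vs'" using ne' s(1) by (simp add: ys_def)
    then have "abs ` set ys = {1..int m} \<union> {int m + 1..int n}"
      using sets by (metis image_Un list.set_map set_append)
    then have "int n \<in> abs ` set ys" using mn by auto
    \<comment> \<open>The merged list starts at \<open>i\<close>, up to its mark; a last rotation
      gives the required start at \<open>n\<close>.\<close>
    then obtain c where c: "\<bar>hd (rotate c ys)\<bar> = int n" by (rule obtain_rotation_with_hd)
    have "length ys = n"
      using ne' len by (simp add: ys_def) (simp add: us'_def vs'_def)
    moreover have "is_cycle_notation n w\<^sub>0 (rotate c ys)"
      using c merge(2) \<open>w\<^sub>0 = marked_cycle n ys\<close>
      by (simp add: is_cycle_notation_def marked_cycle_rotate)
    ultimately show ?thesis by (intro exI[of _ "rotate c ys"]) simp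
  qed
  moreover have "even (length (filter (\<lambda>x. x < 0) xs)) \<and>
      reduced_decomposition (type_D n) (reflections n) w\<^sub>0 (rev (type_I_reflections n xs))"
    if "length xs = n" "is_cycle_notation n w\<^sub>0 xs" for xs
  proof -
    have xs: "is_marked_cycle n xs" "w\<^sub>0 = marked_cycle n xs"
      using that(2) by (auto simp: is_cycle_notation_def)
    \<comment> \<open>The parity follows from membership of \<open>w\<^sub>0\<close> in W,
      independently of how the notation was obtained.\<close>
    then have "even (length (filter (\<lambda>x. x < 0) xs))"
      using marked_cycle_in_type_D_iff w0_carrier by simp
    then show ?thesis using reduced_decomposition_type_I xs that(1) by simp
  qed
  ultimately show ?thesis using w_carrier by blast
qed

end
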